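(* Let $c>0$ and let $\sigma_*\ge1$ be an integer. Assume that $c_0(t)\ge0$ for all $t\ge0$ and that $(\rho(t),\eta(t))$, $t\ge0$, solves the initial value problem $$\frac{d}{dt}\begin{pmatrix}\rho(t)\\ \eta(t)\end{pmatrix}=\bar F(\rho(t),\eta(t)),\qquad(\rho(0),\eta(0))=(\rho_0,\eta_0),$$ with initial data $(\rho(0),\eta(0))\in D$, where $D$ and $\bar F$ (which depends on $t$ through $c_0(t)$) are as defined in the context. Then $(\rho(t),\eta(t))\in D$ for all $t\ge0$.
   Context: $D=\{(\rho,\eta)\in\mathbb{R}^2: 0\le\rho\le\eta\}$. For $0<\rho<\eta$ put $p=\rho/\eta$ and $r=\rho^2/(\eta-\rho)$. Define $P_n:D\to\mathbb{R}$ by $$P_0(\rho,\eta)=\begin{cases}1,&0=\rho\le\eta,\\ p^r,&0<\rho<\eta,\\ e^{-\rho},&0<\rho=\eta,\end{cases}$$ and for integers $n>0$ $$P_n(\rho,\eta)=\begin{cases}0,&0=\rho\le\eta,\\ (1-p)^np^r\,\frac1{n!}\prod_{i=1}^n(n+r-i),&0<\rho<\eta,\\ \frac{\rho^n}{n!}e^{-\rho},&0<\rho=\eta.\end{cases}$$ Define $F=(F_1,F_2)^\top:D\to\mathbb{R}^2$ (depending also on $t$ through $c_0(t)$) by $$F_1(\rho,\eta)=c_0(t)-c+\frac{c}{\sigma_*}\sum_{i=0}^{\sigma_*-1}(\sigma_*-i)P_i(\rho,\eta),$$ $$F_2(\rho,\eta)=c_0(t)+c-\frac{c}{\sigma_*}\sum_{i=0}^{\sigma_*-1}(2\rho-2i+1)(\sigma_*-i)P_i(\rho,\eta).$$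 Define $\bar F:\mathbb{R}^2\to\mathbb{R}^2$ by $\bar F(\rho,\eta)=F(\mathrm{proj}_D(\rho,\eta))$, where $\mathrm{proj}_D$ is the Euclidean (2-norm) projection onto the closed convex set $D$. *)

theory Defs
  imports "HOL-Analysis.Analysis"
begin

definition D :: "(real \<times> real) set" where
  "D = {(\<rho>, \<eta>). 0 \<le> \<rho> \<and> \<rho> \<le> \<eta>}"

text \<open>\<open>P n\<close> is only meaningful on \<open>D\<close>; the value \<open>0\<close> outside \<open>D\<close> is a dummy that \<open>Fbar\<close> below
  never uses.\<close>

definition P :: "nat \<Rightarrow> real \<times> real \<Rightarrow> real" where
  "P n = (\<lambda>(\<rho>, \<eta>).
     let p = \<rho> / \<eta>; r = \<rho>\<^sup>2 / (\<eta> - \<rho>) in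
     if n = 0 then
       (if 0 = \<rho> \<and> \<rho> \<le> \<eta> then 1
        else if 0 < \<rho> \<and> \<rho> < \<eta> then p powr r
        else if 0 < \<rho> \<and> \<rho> = \<eta> then exp (- \<rho>)
        else 0)
     else
       (if 0 = \<rho> \<and> \<rho> \<le> \<eta> then 0
        else if 0 < \<rho> \<and> \<rho> < \<eta> then
          (1 - p) ^ n * p powr r * (1 / fact n) * (\<Prod>i = 1..n. real n + r - real i)
        else if 0 < \<rho> \<and> \<rho> = \<eta> then \<rho> ^ n / fact n * exp (- \<rho>)
        else 0))"

definition F1 :: "real \<Rightarrow> nat \<Rightarrow> (real \<Rightarrow> real) \<Rightarrow> real \<Rightarrow> real \<times> real \<Rightarrow> real" where
  "F1 c \<sigma> c0 t = (\<lambda>(\<rho>, \<eta>).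
     c0 t - c + c / real \<sigma> * (\<Sum>i = 0..<\<sigma>. (real \<sigma> - real i) * P i (\<rho>, \<eta>)))"

definition F2 :: "real \<Rightarrow> nat \<Rightarrow> (real \<Rightarrow> real) \<Rightarrow> real \<Rightarrow> real \<times> real \<Rightarrow> real" where
  "F2 c \<sigma> c0 t = (\<lambda>(\<rho>, \<eta>).
     c0 t + c - c / real \<sigma> *
       (\<Sum>i = 0..<\<sigma>. (2 * \<rho> - 2 * real i + 1) * (real \<sigma> - real i) * P i (\<rho>, \<eta>)))"

definition F :: "real \<Rightarrow> nat \<Rightarrow> (real \<Rightarrow> real) \<Rightarrow> real \<Rightarrow> real \<times> real \<Rightarrow> real \<times> real" where
  "F c \<sigma> c0 t x = (F1 c \<sigma> c0 t x, F2 c \<sigma> c0 t x)"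

text \<open>The product metric on \<^typ>\<open>real \<times> real\<close> is the Euclidean one, so \<^const>\<open>closest_point\<close> is the
  2-norm projection onto the nonempty closed convex set \<open>D\<close>.\<close>

definition Fbar :: "real \<Rightarrow> nat \<Rightarrow> (real \<Rightarrow> real) \<Rightarrow> real \<Rightarrow> real \<times> real \<Rightarrow> real \<times> real" where
  "Fbar c \<sigma> c0 t x = F c \<sigma> c0 t (closest_point D x)"

end

theory Submission
  imports Defs
begin

text \<open>\<open>D\<close> is cut out by the two constraints \<open>\<rho> \<ge> 0\<close> and \<open>\<eta> - \<rho> \<ge> 0\<close>, and each can be treated on its
  own: a violated constraint is active at the projected point, where it is nondecreasing along
  the vector field. On the edge \<open>\<rho> = 0\<close> one has \<open>F = (c\<^sub>0, c\<^sub>0)\<close>. On the edge \<open>\<rho> = \<eta>\<close> the \<open>P\<^sub>i\<close>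
  are Poisson weights, and \<open>\<rho> P\<^sub>i = (i + 1) P\<^sub>i\<^sub>+\<^sub>1\<close> makes the sum in \<open>F\<^sub>2 - F\<^sub>1\<close> telescope to
  \<open>2c (1 - (P\<^sub>0 + \<dots> + P\<^sub>\<sigma>)) \<ge> 0\<close>.\<close>

text \<open>The obtuse-angle inequality holds at \<open>x\<close> by assumption and at the true
  projection by optimality. Testing each point against the other and adding gives squared distance
  at most 0.\<close>

lemma closest_point_eqI:
  fixes S :: "'a::euclidean_space set"
  assumes "convex S" "closed S" "x \<in> S"
    and obtuse: "\<And>z. z \<in> S \<Longrightarrow> inner (a - x) (z - x) \<le> 0"
  shows "closest_point S a = x"
proof -
  let ?y = "closest_point S a"
  have y: "?y \<in> S"
    using assms(2,3) closest_point_in_set by blast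
  have "inner (a - ?y) (x - ?y) \<le> 0"
    by (rule closest_point_dot[OF assms(1-3)])
  with obtuse[OF y] have "inner (x - ?y) (x - ?y) \<le> 0"
    by (simp add: inner_diff_left inner_diff_right inner_commute)
  then have "inner (x - ?y) (x - ?y) = 0"
    using inner_ge_zero by (rule order_antisym)
  then show ?thesis by simp
qed

text \<open>After the last time \<open>s\<close> before \<open>t\<close> at which \<open>g\<close>
  is nonnegative, \<open>g\<close> stays negative and hence cannot decrease, so
  \<open>g t \<ge> g s \<ge> 0\<close>. At \<open>a\<close> itself only continuity is asked, which
  suits a one-sided derivative at the initial time.\<close>

lemma nonneg_if_nondecreasing_while_negative:
  fixes g :: "real \<Rightarrow> real"
  assumes cont: "continuous_on {a..} g" and "g a \<ge> 0"
    and deriv: "\<And>t. t > a \<Longrightarrow> g t < 0 \<Longrightarrow> \<exists>y\<ge>0. (g has_real_derivative y) (at t)"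
    and "t \<ge> a"
  shows "g t \<ge> 0"
proof (rule ccontr)
  assume "\<not> g t \<ge> 0"
  \<comment> \<open>Compactness of \<open>A\<close> supplies the last nonnegative time.\<close>
  define A where "A = {a..t} \<inter> g -` {0..}"
  have "closed A" unfolding A_def
    by (intro continuous_closed_preimage continuous_on_subset[OF cont]) auto
  moreover have "bounded A"
    unfolding A_def by (rule bounded_subset[of "{a..t}"]) auto
  ultimately have "compact A" by (simp add: compact_eq_bounded_closed)
  moreover have "a \<in> A" using assms by (simp add: A_def)
  ultimately obtain s where s: "s \<in> A" and max: "\<And>u. u \<in> A \<Longrightarrow> u \<le> s"
    using compact_attains_sup[of A] by blast
  have "g s \<ge> 0" "a \<le> s" "s \<le> t" using s by (auto simp: A_def)
  have neg: "g u < 0" if "s < u" "u \<le> t" for u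
    using max[of u] that \<open>a \<le> s\<close> by (force simp: A_def)
  have "g s \<le> g t"
  proof (rule DERIV_nonneg_imp_increasing_open[OF \<open>s \<le> t\<close>])
    show "\<exists>y. (g has_real_derivative y) (at u) \<and> 0 \<le> y" if "s < u" "u < t" for u
      using deriv[of u] neg[of u] that \<open>a \<le> s\<close> by auto
    show "continuous_on {s..t} g"
      using \<open>a \<le> s\<close> by (intro continuous_on_subset[OF cont]) auto
  qed
  with \<open>g s \<ge> 0\<close> \<open>\<not> g t \<ge> 0\<close> show False by simp
qed

lemma convex_D: "convex D"
proof -
  have *: "D = {x. inner (-1, 0) x \<le> 0} \<inter> {x. inner (1, -1) x \<le> 0}"
    by (auto simp: D_def)
  show ?thesis
    unfolding * by (intro convex_Int convex_halfspace_le)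
qed

lemma closed_D: "closed D"
proof -
  have *: "D = {x. inner (-1, 0) x \<le> 0} \<inter> {x. inner (1, -1) x \<le> 0}"
    by (auto simp: D_def)
  show ?thesis
    unfolding * by (intro closed_Int closed_halfspace_le)
qed

text \<open>The projection is horizontal onto the edge \<open>\<rho> = 0\<close>; for negative
  \<open>\<eta>\<close> it lands in the corner, whence the \<open>max\<close>.\<close>

lemma closest_point_D_left:
  assumes "\<rho> < 0"
  shows "closest_point D (\<rho>, \<eta>) = (0, max 0 \<eta>)"
  by (rule closest_point_eqI[OF convex_D closed_D])
    (use assms in \<open>auto simp: D_def max_def mult_nonneg_nonpos mult_nonneg_nonpos2 
      intro!: add_nonpos_nonpos\<close>)

lemma closest_point_D_below:
  assumes "\<eta> < \<rho>"
  shows "closest_point D (\<rho>, \<eta>) = (max 0 ((\<rho> + \<eta>) / 2), max 0 ((\<rho> + \<eta>) / 2))"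
proof (rule closest_point_eqI[OF convex_D closed_D])
  fix z assume "z \<in> D"
  then obtain u v where z: "z = (u, v)" "0 \<le> u" "u \<le> v"
    by (auto simp: D_def)
  show "inner ((\<rho>, \<eta>) - (max 0 ((\<rho> + \<eta>) / 2), max 0 ((\<rho> + \<eta>) / 2)))
      (z - (max 0 ((\<rho> + \<eta>) / 2), max 0 ((\<rho> + \<eta>) / 2))) \<le> 0"
  proof (cases "\<rho> + \<eta> > 0")
    case True
    \<comment> \<open>With the midpoint as foot, the inner product is half of this.\<close>
    have "(\<rho> - \<eta>) * (u - v) \<le> 0"
      using assms z by (intro mult_nonneg_nonpos) auto
    then show ?thesis using True z by (simp add: max_def field_simps)
  next
    case False
    \<comment> \<open>The foot is the origin, and the inner product
      \<open>\<rho> * u + \<eta> * v\<close> is the sum of these two terms. Here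
      \<open>\<eta> < 0\<close>, since \<open>2 * \<eta> < \<rho> + \<eta> \<le> 0\<close>.\<close>
    have "(\<rho> + \<eta>) * u \<le> 0" "\<eta> * (v - u) \<le> 0"
      using assms z False by (auto intro!: mult_nonpos_nonneg)
    then show ?thesis using False z by (simp add: max_def algebra_simps)
  qed
qed (auto simp: D_def max_def)

text \<open>Only the term \<open>i = 0\<close> survives, with weight \<open>\<sigma>\<close> in both
  sums, so the constants \<open>c\<close> cancel. The corner \<open>y = 0\<close> is
  included.\<close>

lemma F_left_edge:
  assumes "\<sigma> \<ge> 1" "y \<ge> 0"
  shows "F c \<sigma> c0 t (0, y) = (c0 t, c0 t)"
proof -
  have *: "P i (0, y) = (if i = 0 then 1 else 0)" for i
    using assms by (simp add: P_def)
  show ?thesis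
    using assms by (simp add: F_def F1_def F2_def * if_distrib[of "(*) _"] cong: if_cong)
qed

lemma P_diagonal:
  assumes "m > 0"
  shows "P i (m, m) = m ^ i / fact i * exp (- m)"
  using assms by (simp add: P_def)

text \<open>A partial sum of the exponential series is at most \<open>exp m\<close>, all terms being
  positive.\<close>

lemma sum_P_diagonal_le_1:
  assumes "m > 0"
  shows "(\<Sum>i\<le>n. P i (m, m)) \<le> 1"
proof -
  have "(\<Sum>i\<le>n. m ^ i / fact i) \<le> exp m"
    using sum_le_suminf[OF summable_exp[of m], of "{..n}"] assms
    by (simp add: exp_def divide_inverse mult.commute)
  then have "(\<Sum>i\<le>n. m ^ i / fact i) * exp (- m) \<le> exp m * exp (- m)"
    by (intro mult_right_mono) auto
  then show ?thesis
    using assms by (simp add: P_diagonal sum_distrib_right flip: exp_add)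
qed

lemma sum_P_diagonal:
  assumes "m > 0"
  shows "(\<Sum>i<n. (m - real i + 1) * (real n - real i) * P i (m, m))
    = real n * (\<Sum>i\<le>n. P i (m, m))"
proof -
  have rec: "m * P i (m, m) = real (Suc i) * P (Suc i) (m, m)" for i
    using assms by (simp add: P_diagonal field_simps del: of_nat_Suc)
  \<comment> \<open>For the induction the summation bound \<open>k\<close> is decoupled from the
    \<open>n\<close> in the weights. At \<open>k = n\<close> the remainder is
    \<open>n * P n (m, m)\<close>, which extends the sum to \<open>i \<le> n\<close>.\<close>
  have "(\<Sum>i<k. (m - real i + 1) * (real n - real i) * P i (m, m))
    = real n * (\<Sum>i<k. P i (m, m)) + (real n + 1 - real k) * real k * P k (m, m)" for k
  proof (induction k)
    case (Suc k)
    have "(m - real k + 1) * (real n - real k) * P k (m, m)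
      = (real n - real k) * (m * P k (m, m)) + (1 - real k) * (real n - real k) * P k (m, m)"
      by (simp add: algebra_simps)
    also have "(real n - real k) * (m * P k (m, m))
      = (real n + 1 - real (Suc k)) * real (Suc k) * P (Suc k) (m, m)"
      unfolding rec by simp
    finally show ?case
      by (simp only: sum.lessThan_Suc Suc.IH) (simp only: algebra_simps)
  qed simp
  from this[of n] show ?thesis
    by (simp add: lessThan_Suc_atMost[symmetric] algebra_simps)
qed

lemma F1_le_F2_diagonal:
  assumes "c > 0" "\<sigma> \<ge> 1" "m \<ge> 0"
  shows "F1 c \<sigma> c0 t (m, m) \<le> F2 c \<sigma> c0 t (m, m)"
proof (cases "m = 0")
  case True
  \<comment> \<open>The corner also lies on the left edge, where both components equal
    \<open>c0 t\<close>.\<close>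
  with F_left_edge[of \<sigma> 0 c c0 t] assms show ?thesis by (simp add: F_def)
next
  case False
  with assms have m: "m > 0" by simp
  define a where "a = (\<lambda>i. (real \<sigma> - real i) * P i (m, m))"
  have "F2 c \<sigma> c0 t (m, m) - F1 c \<sigma> c0 t (m, m)
    = 2 * c - c / real \<sigma> * ((\<Sum>i<\<sigma>. (2 * m - 2 * real i + 1) * a i) + (\<Sum>i<\<sigma>. a i))"
    by (simp add: F1_def F2_def a_def algebra_simps flip: atLeast0LessThan)
  \<comment> \<open>The sum from \<open>F1\<close> raises the factor to
    \<open>2 * (m - i + 1)\<close>, the form that telescopes.\<close>
  also have "(\<Sum>i<\<sigma>. (2 * m - 2 * real i + 1) * a i) + (\<Sum>i<\<sigma>. a i)
    = 2 * (\<Sum>i<\<sigma>. (m - real i + 1) * (real \<sigma> - real i) * P i (m, m))"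
    unfolding a_def sum_distrib_left sum.distrib[symmetric]
    by (intro sum.cong) (auto simp: algebra_simps)
  also have "2 * c - c / real \<sigma> * \<dots> = 2 * c * (1 - (\<Sum>i\<le>\<sigma>. P i (m, m)))"
    unfolding sum_P_diagonal[OF m] using assms by (simp add: right_diff_distrib)
  also have "\<dots> \<ge> 0"
    using assms sum_P_diagonal_le_1[OF m] by simp
  finally show ?thesis by simp
qed

theorem theorem8:
  fixes c :: real and \<sigma> :: nat and c0 \<rho> \<eta> :: "real \<Rightarrow> real" and \<rho>0 \<eta>0 :: real
  assumes c_pos: "c > 0"
    and sigma_ge_1: "\<sigma> \<ge> 1"
    and c0_nonneg: "\<And>t. t \<ge> 0 \<Longrightarrow> c0 t \<ge> 0"
    and ode: "\<And>t. t \<ge> 0 \<Longrightarrow>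
      ((\<lambda>s. (\<rho> s, \<eta> s)) has_vector_derivative Fbar c \<sigma> c0 t (\<rho> t, \<eta> t)) (at t within {0..})"
    and initial: "(\<rho> 0, \<eta> 0) = (\<rho>0, \<eta>0)"
    and initial_in_D: "(\<rho>0, \<eta>0) \<in> D"
  shows "\<forall>t\<ge>0. (\<rho> t, \<eta> t) \<in> D"
proof -
  have \<rho>': "(\<rho> has_vector_derivative fst (Fbar c \<sigma> c0 t (\<rho> t, \<eta> t))) (at t within {0..})"
    and \<eta>': "(\<eta> has_vector_derivative snd (Fbar c \<sigma> c0 t (\<rho> t, \<eta> t))) (at t within {0..})"
    if "t \<ge> 0" for t
    using bounded_linear.has_vector_derivative[OF bounded_linear_fst ode[OF that]]
      bounded_linear.has_vector_derivative[OF bounded_linear_snd ode[OF that]] by simp_all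
  note diff' = has_vector_derivative_diff[OF \<eta>' \<rho>']
  have at: "at t within {0..} = at t" if "t > 0" for t :: real
    using that by (intro at_within_interior) simp
  have init: "\<rho> 0 \<ge> 0" "\<eta> 0 - \<rho> 0 \<ge> 0"
    using initial initial_in_D by (auto simp: D_def)
  have "\<rho> t \<ge> 0" if "t \<ge> 0" for t
  proof (rule nonneg_if_nondecreasing_while_negative[where a = 0 and g = \<rho>, OF _ init(1) _ that])
    show "continuous_on {0..} \<rho>"
      by (rule continuous_on_vector_derivative[OF \<rho>']) simp
    \<comment> \<open>The projected point is on the left edge, so the derivative is
      \<open>c0 t\<close>.\<close>
    show "\<exists>y\<ge>0. (\<rho> has_real_derivative y) (at t)" if "t > 0" "\<rho> t < 0" for t
      using \<rho>'[of t] c0_nonneg[of t] that sigma_ge_1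
      by (auto simp: Fbar_def closest_point_D_left F_left_edge at
          has_real_derivative_iff_has_vector_derivative)
  qed
  moreover have "\<eta> t - \<rho> t \<ge> 0" if "t \<ge> 0" for t
  proof (rule nonneg_if_nondecreasing_while_negative[where a = 0 and g = "\<lambda>t. \<eta> t - \<rho> t", OF _ init(2) _ that])
    show "continuous_on {0..} (\<lambda>t. \<eta> t - \<rho> t)"
      by (rule continuous_on_vector_derivative[OF diff']) simp_all
    show "\<exists>y\<ge>0. ((\<lambda>t. \<eta> t - \<rho> t) has_real_derivative y) (at t)"
      if "t > 0" "\<eta> t - \<rho> t < 0" for t
    proof -
      \<comment> \<open>Both coordinates of the projected point equal \<open>m\<close>.\<close>
      define m where "m = max 0 ((\<rho> t + \<eta> t) / 2)"
      have "Fbar c \<sigma> c0 t (\<rho> t, \<eta> t) = (F1 c \<sigma> c0 t (m, m), F2 c \<sigma> c0 t (m, m))"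
        using that by (simp add: Fbar_def F_def closest_point_D_below m_def)
      moreover have "F1 c \<sigma> c0 t (m, m) \<le> F2 c \<sigma> c0 t (m, m)"
        by (intro F1_le_F2_diagonal c_pos sigma_ge_1) (simp add: m_def)
      ultimately show ?thesis
        using diff'[of t] that
        by (auto simp: at has_real_derivative_iff_has_vector_derivative
            intro!: exI[of _ "F2 c \<sigma> c0 t (m, m) - F1 c \<sigma> c0 t (m, m)"])
    qed
  qed
  ultimately show ?thesis by (auto simp: D_def)
qed

end
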